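(* Let $A$ be a finite alphabet and let $X \subset A^{\mathbb{Z}}$ be a subshift that has a finite number of $\sigma^{\pm}$-chain components. Suppose that the dynamical system $(X, \sigma)$ has a finite factor that does not consist of fixed points, i.e., there are a finite (discrete) dynamical system $(Y, g)$ with $g \neq \mathrm{id}_Y$ and a continuous surjection $\pi : X \to Y$ with $\pi \circ \sigma = g \circ \pi$. Then there is no cellular automaton $f : A^{\mathbb{Z}} \to A^{\mathbb{Z}}$ with generic limit set $\tilde\omega(f) = X$.
   Context: $\mathbb{N}$ contains $0$. For a finite alphabet $A$, the full shift $A^{\mathbb{Z}}$ has the product topology (a compact metrizable space), and the left shift $\sigma$ is given by $\sigma(x)_i = x_{i+1}$. A cellular automaton (CA) on $A^{\mathbb{Z}}$ is a continuous map $f : A^{\mathbb{Z}} \to A^{\mathbb{Z}}$ commuting with $\sigma$. A subset of a topological space is comeager if it contains an intersection of countably many dense open sets. For $x \in A^{\mathbb{Z}}$, $\omega(x)$ is the set of limit points (limits of subsequences) of the forward orbit $(f^t(x))_{t\in\mathbb{N}}$. For $Y \subset A^{\mathbb{Z}}$, the realm of attraction is $\mathfrak{D}(Y) = \{x \in A^{\mathbb{Z}} \mid \omega(x) \subset Y\}$. The generic limit set $\tilde\omega(f)$ is the intersection of all closed sets $C \subset A^{\mathbb{Z}}$ such that $\mathfrak{D}(C)$ is comeager. A subshift is a closed $\sigma$-invariant set $X \subset A^{\mathbb{Z}}$. For $w \in A^*$, $[w] = \{x \in A^{\mathbb{Z}} \mid x_{[0,|w|)} = w\}$; $\mathcal{L}(X)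 = \{w \in A^* \mid [w] \cap X \neq \emptyset\}$ and $\mathcal{L}_n(X) = \mathcal{L}(X) \cap A^n$. The chain relation of width $n$ is the relation $\sim_n$ on $\mathcal{L}_n(X)$ defined by $u \sim_n v$ if there exist $x \in X$ and $k \geq 0$ with $x_{[0,n)} = u$ and $x_{[k,k+n)} = v$. The symmetric and transitive closure of $\sim_n$ is the $\sigma^{\pm}$-chain relation of width $n$. If for each $n$ the $\sigma^{\pm}$-chain relation of width $n$ equals $\mathcal{L}_n(X)^2$, then $X$ is called $\sigma^{\pm}$-chain transitive. A $\sigma^{\pm}$-chain component of $X$ is a maximal (with respect to inclusion) $\sigma^{\pm}$-chain transitive subshift contained in $X$. Every subshift is the disjoint union of its $\sigma^{\pm}$-chain components. *)

theory Defs
  imports "HOL-Analysis.Analysis"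
begin

(* The alphabet is a type of class finite and discrete_topology, so the topology of
   the function type is the product topology on the full shift. *)

type_synonym 'a config = "int \<Rightarrow> 'a"

definition shift :: "'a config \<Rightarrow> 'a config" where
  "shift x = (\<lambda>i. x (i + 1))"

definition cellular_automaton ::
    "('a::{finite,discrete_topology} config \<Rightarrow> 'a config) \<Rightarrow> bool" where
  "cellular_automaton f \<longleftrightarrow> continuous_on UNIV f \<and> f \<circ> shift = shift \<circ> f"

definition comeager :: "'a::topological_space set \<Rightarrow> bool" where
  "comeager S \<longleftrightarrow>
     (\<exists>G. countable G \<and> (\<forall>U\<in>G. open U \<and> closure U = UNIV) \<and> \<Inter>G \<subseteq> S)"

definition omega_limit :: "('a::topological_space \<Rightarrow> 'a) \<Rightarrow> 'a \<Rightarrow> 'a set" where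
  "omega_limit f x =
     {y. \<exists>r::nat \<Rightarrow> nat. strict_mono r \<and> (\<lambda>n. (f ^^ r n) x) \<longlonglongrightarrow> y}"

definition realm :: "('a::topological_space \<Rightarrow> 'a) \<Rightarrow> 'a set \<Rightarrow> 'a set" where
  "realm f Y = {x. omega_limit f x \<subseteq> Y}"

definition generic_limit_set :: "('a::topological_space \<Rightarrow> 'a) \<Rightarrow> 'a set" where
  "generic_limit_set f = \<Inter>{C. closed C \<and> comeager (realm f C)}"

(* For two-sided subshifts, invariance is equality, not mere inclusion. *)
definition subshift :: "'a::{finite,discrete_topology} config set \<Rightarrow> bool" where
  "subshift X \<longleftrightarrow> closed X \<and> shift ` X = X"

(* The word of length n that x carries at the positions i, ..., i + n - 1. *)
definition window :: "'a config \<Rightarrow> int \<Rightarrow> nat \<Rightarrow> 'a list" where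
  "window x i n = map (\<lambda>j. x (i + int j)) [0..<n]"

definition cylinder :: "'a list \<Rightarrow> 'a config set" where
  "cylinder w = {x. window x 0 (length w) = w}"

definition language :: "'a config set \<Rightarrow> 'a list set" where
  "language X = {w. cylinder w \<inter> X \<noteq> {}}"

definition language_n :: "nat \<Rightarrow> 'a config set \<Rightarrow> 'a list set" where
  "language_n n X = {w \<in> language X. length w = n}"

definition chain_rel :: "nat \<Rightarrow> 'a config set \<Rightarrow> 'a list rel" where
  "chain_rel n X =
     {(u, v). u \<in> language_n n X \<and> v \<in> language_n n X \<and>
        (\<exists>x\<in>X. \<exists>k::nat. window x 0 n = u \<and> window x (int k) n = v)}"

definition pm_chain_rel :: "nat \<Rightarrow> 'a config set \<Rightarrow> 'a list rel" where
  "pm_chain_rel n X = (chain_rel n X \<union> (chain_rel n X)\<inverse>)\<^sup>+"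

definition pm_chain_transitive :: "'a config set \<Rightarrow> bool" where
  "pm_chain_transitive X \<longleftrightarrow>
     (\<forall>n. pm_chain_rel n X = language_n n X \<times> language_n n X)"

definition pm_chain_components ::
    "'a::{finite,discrete_topology} config set \<Rightarrow> 'a config set set" where
  "pm_chain_components X =
     {C. subshift C \<and> pm_chain_transitive C \<and> C \<subseteq> X \<and>
         (\<forall>D. subshift D \<and> pm_chain_transitive D \<and> D \<subseteq> X \<and> C \<subseteq> D \<longrightarrow> D = C)}"

end

theory Submission
  imports Defs
begin

text \<open>
  Suppose \<open>generic_limit_set f = X\<close> for a cellular automaton \<open>f\<close>. Since \<open>g\<close> permutes the finite set \<open>Y\<close>, some \<open>p > 0\<close>
  satisfies \<open>g\<^sup>p = id\<close>, and the fibre \<open>E\<^sub>0\<close> of a point moved by \<open>g\<close> is a \<open>\<sigma>\<^sup>p\<close>-invariant clopen subset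
  of \<open>X\<close> that is disjoint from \<open>\<sigma> E\<^sub>0\<close>. Every shift-invariant clopen set is a union of chain components,
  so finitely many components leave only finitely many \<open>\<sigma>\<^sup>p\<close>-invariant clopen sets. They are determined
  by a common window \<open>[-N, N]\<close>, and as \<open>f\<close> pulls them back to each other, the state of a
  configuration at the origin, i.e. the collection of those sets that its window selects, evolves
  deterministically as long as the configuration looks like a point of \<open>X\<close> near the origin. By Baire
  category there are a nonempty open set \<open>W\<close> and a time from which all points of \<open>W\<close> have the same state
  at every step, infinitely often a state in \<open>E\<^sub>0\<close>. A generic point \<open>x\<close> of
  \<open>W \<inter> \<sigma>\<^sup>-\<^sup>d W\<close> with \<open>d \<equiv> 1\<close> modulo \<open>p\<close> then has, at some late time, the state \<open>E\<^sub>0\<close> both at \<open>0\<close> and at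
  \<open>d\<close>, while the whole stretch in between is legal for \<open>X\<close>; this gives a point of \<open>E\<^sub>0 \<inter> \<sigma>\<^sup>-\<^sup>d E\<^sub>0\<close>,
  contradicting \<open>E\<^sub>0 \<inter> \<sigma>\<^sup>-\<^sup>1 E\<^sub>0 = {}\<close>.
\<close>

subsection \<open>Locality on the full shift\<close>

text \<open>Makes the space of configurations, a countable product, first countable. Compact sets of
  configurations are then sequentially compact, which the subsequence limits in
  \<open>omega_limit\<close> require.\<close>

instance discrete_topology \<subseteq> first_countable_topology
proof
  fix x :: 'a
  show "\<exists>A::nat \<Rightarrow> 'a set. (\<forall>i. x \<in> A i \<and> open (A i)) \<and>
      (\<forall>S. open S \<and> x \<in> S \<longrightarrow> (\<exists>i. A i \<subseteq> S))"
    by (rule exI[of _ "\<lambda>_. {x}"]) (auto simp: open_discrete)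
qed

definition agree :: "nat \<Rightarrow> 'a config \<Rightarrow> 'a config \<Rightarrow> bool" where
  "agree N x y \<longleftrightarrow> (\<forall>i. \<bar>i\<bar> \<le> int N \<longrightarrow> x i = y i)"

text \<open>The union of the centred cylinders of radius \<open>N\<close> that meet
  \<open>E\<close>. For \<open>E = X\<close>, membership only says that the pattern on [-N, N]
  occurs there in a point of \<open>X\<close>, so it is a local test of legality.\<close>

definition nbhd :: "nat \<Rightarrow> 'a config set \<Rightarrow> 'a config set" where
  "nbhd N E = {z. \<exists>y\<in>E. agree N z y}"

lemma agree_refl [simp]: "agree N x x"
  by (simp add: agree_def)

lemma agree_sym: "agree N x y \<Longrightarrow> agree N y x"
  by (simp add: agree_def)

lemma agree_trans: "agree N x y \<Longrightarrow> agree N y z \<Longrightarrow> agree N x z"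
  by (simp add: agree_def)

lemma agree_mono: "agree N x y \<Longrightarrow> M \<le> N \<Longrightarrow> agree M x y"
  by (force simp: agree_def)

lemma open_coordinate:
  fixes S :: "'a::discrete_topology set"
  shows "open {x::'a config. x i \<in> S}"
proof -
  have "continuous_on UNIV (\<lambda>x::'a config. x i)"
    by (rule continuous_on_product_coordinates)
  then have "open ((\<lambda>x::'a config. x i) -` S)"
    by (rule open_vimage[rotated]) (rule open_discrete)
  then show ?thesis by (simp add: vimage_def)
qed

lemma open_agree:
  fixes x :: "'a::discrete_topology config"
  shows "open {z. agree N z x}"
proof -
  have "{z. agree N z x} = (\<Inter>i\<in>{- int N..int N}. {z. z i \<in> {x i}})"
    by (auto simp: agree_def abs_le_iff)
  also have "open \<dots>"
    by (intro open_INT finite_atLeastAtMost_int ballI open_coordinate)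
  finally show ?thesis .
qed

lemma open_nbhd:
  fixes E :: "'a::discrete_topology config set"
  shows "open (nbhd N E)"
proof -
  have "nbhd N E = (\<Union>y\<in>E. {z. agree N z y})" by (auto simp: nbhd_def)
  then show ?thesis by (metis open_UN open_agree)
qed

lemma subset_nbhd: "E \<subseteq> nbhd N E"
  by (auto simp: nbhd_def intro: agree_refl)

text \<open>\<open>agree N\<close> is an equivalence relation with open classes, and the complement
  of a union of classes is again a union of classes.\<close>

lemma closed_nbhd:
  fixes E :: "'a::discrete_topology config set"
  shows "closed (nbhd N E)"
proof -
  have "- nbhd N E = nbhd N (- nbhd N E)"
  proof
    show "nbhd N (- nbhd N E) \<subseteq> - nbhd N E"
      unfolding nbhd_def by (blast intro: agree_trans agree_sym)
  qed (rule subset_nbhd)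
  then show ?thesis by (metis open_nbhd closed_def)
qed

lemma agree_basis:
  fixes U :: "'a::discrete_topology config set"
  assumes "open U" "x \<in> U"
  obtains N where "{z. agree N z x} \<subseteq> U"
proof -
  have "openin (product_topology (\<lambda>i. euclidean) UNIV) U"
    using assms(1) by (simp add: open_fun_def)
  from product_topology_open_contains_basis[OF this assms(2)]
  obtain B where B: "x \<in> (\<Pi>\<^sub>E i\<in>UNIV. B i)" "finite {i. B i \<noteq> UNIV}" "(\<Pi>\<^sub>E i\<in>UNIV. B i) \<subseteq> U"
    by auto
  \<comment> \<open>The inserted 0 keeps the set nonempty when no coordinate is constrained.\<close>
  define N where "N = nat (Max ((\<lambda>i. \<bar>i\<bar>) ` insert 0 {i. B i \<noteq> UNIV}))"
  have bd: "\<bar>i\<bar> \<le> int N" if "B i \<noteq> UNIV" for i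
  proof -
    have "\<bar>i\<bar> \<le> Max ((\<lambda>i. \<bar>i\<bar>) ` insert 0 {i. B i \<noteq> UNIV})"
      using B(2) that by (intro Max_ge) auto
    then show ?thesis unfolding N_def by linarith
  qed
  have "z \<in> U" if "agree N z x" for z
  proof -
    have "z i \<in> B i" for i
      using bd[of i] that B(1) by (cases "B i = UNIV") (auto simp: agree_def PiE_iff)
    then show ?thesis using B(3) by auto
  qed
  then show ?thesis using that by blast
qed

section \<open>Compactness and uniform locality\<close>

lemma compact_config: "compact (UNIV :: 'a::{finite,discrete_topology} config set)"
proof -
  have "compact_space (product_topology (\<lambda>i::int. euclidean :: 'a topology) UNIV)"
    unfolding compact_space_product_topology
    by (simp add: compact_space_def finite_imp_compact)
  then show ?thesis
    by (simp add: euclidean_product_topology compact_space_def)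
qed

lemma closed_imp_compact_config:
  fixes K :: "'a::{finite,discrete_topology} config set"
  shows "closed K \<Longrightarrow> compact K"
  using closed_Int_compact[OF _ compact_config] by simp

text \<open>By compactness finitely many cylinders, on each of which \<open>h\<close> is constant
  within \<open>K\<close>, cover \<open>K\<close>; the largest of their radii serves everywhere. The
  values of \<open>h\<close> carry no topology, so \<open>h\<close> may be a membership test or a
  class of configurations.\<close>

lemma locally_constant_imp_local:
  fixes K :: "'a::{finite,discrete_topology} config set"
  assumes "closed K"
    and loc: "\<And>x. x \<in> K \<Longrightarrow> \<exists>U. open U \<and> x \<in> U \<and> (\<forall>y\<in>U \<inter> K. h y = h x)"
  obtains N where "\<And>x y. x \<in> K \<Longrightarrow> y \<in> K \<Longrightarrow> agree N x y \<Longrightarrow> h x = h y"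
proof -
  have "\<exists>n. \<forall>y\<in>K. agree n y x \<longrightarrow> h y = h x" if "x \<in> K" for x
    using loc[OF that] agree_basis by (metis IntI mem_Collect_eq subsetD)
  then obtain n where n: "\<And>x y. x \<in> K \<Longrightarrow> y \<in> K \<Longrightarrow> agree (n x) y x \<Longrightarrow> h y = h x"
    by metis
  have cover: "K \<subseteq> (\<Union>x\<in>K. {z. agree (n x) z x})" by auto
  obtain F where F: "F \<subseteq> K" "finite F" "K \<subseteq> (\<Union>x\<in>F. {z. agree (n x) z x})"
    by (rule compactE_image[OF closed_imp_compact_config[OF assms(1)] open_agree cover])
  define N where "N = Max (insert 0 (n ` F))"
  have "h x = h y" if "x \<in> K" "y \<in> K" "agree N x y" for x y
  proof -
    obtain c where c: "c \<in> F" "agree (n c) x c" using F(3) \<open>x \<in> K\<close> by auto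
    have "n c \<le> N" using c(1) F(2) by (simp add: N_def)
    then have "agree (n c) y c"
      using that(3) c(2) by (meson agree_mono agree_sym agree_trans)
    then show ?thesis using n that c F(1) by (metis subsetD)
  qed
  then show ?thesis using that by blast
qed

lemma clopen_imp_local:
  fixes X :: "'a::{finite,discrete_topology} config set"
  assumes "E \<subseteq> X" "closed E" "closed (X - E)"
  obtains N where "\<And>x y. x \<in> X \<Longrightarrow> y \<in> X \<Longrightarrow> agree N x y \<Longrightarrow> x \<in> E \<longleftrightarrow> y \<in> E"
proof -
  have "closed X" using closed_Un[OF assms(2,3)] assms(1) by (simp add: Un_absorb1)
  moreover have "\<exists>U. open U \<and> x \<in> U \<and> (\<forall>y\<in>U \<inter> X. (y \<in> E) = (x \<in> E))" if "x \<in> X" for x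
  proof (cases "x \<in> E")
    case True
    then show ?thesis using assms(3) by (intro exI[of _ "- (X - E)"]) (auto simp only: open_Compl)
  next
    case False
    then show ?thesis using assms(2) by (intro exI[of _ "- E"]) auto
  qed
  ultimately show ?thesis
    using locally_constant_imp_local[of X "\<lambda>x. x \<in> E"] that by metis
qed

lemma continuous_imp_local:
  fixes f :: "'a::{finite,discrete_topology} config \<Rightarrow> 'a config"
  assumes "continuous_on UNIV f"
  obtains M where "\<And>x y. agree M x y \<Longrightarrow> agree N (f x) (f y)"
proof -
  \<comment> \<open>The \<open>agree N\<close> class of \<open>f x\<close> is locally constant
    because these classes are open. The resulting radius is that of a local rule, as in the
    Curtis-Hedlund-Lyndon theorem.\<close>
  define h where "h x = {z. agree N (f x) z}" for x
  have h: "h x = h y \<longleftrightarrow> agree N (f x) (f y)" for x y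
    unfolding h_def set_eq_iff mem_Collect_eq by (meson agree_refl agree_sym agree_trans)
  have "\<exists>U. open U \<and> x \<in> U \<and> (\<forall>y\<in>U \<inter> UNIV. h y = h x)" for x
  proof (intro exI conjI)
    show "open (f -` {z. agree N z (f x)})"
      by (rule open_vimage[OF open_agree assms])
  qed (auto simp: h)
  then obtain M where "\<And>x y. agree M x y \<Longrightarrow> h x = h y"
    using locally_constant_imp_local[of UNIV h] by (metis UNIV_I closed_UNIV)
  then show ?thesis using that h by metis
qed

section \<open>Integer translates and two-sided shift invariance\<close>

definition translate :: "int \<Rightarrow> 'a config \<Rightarrow> 'a config" where
  "translate k x = (\<lambda>i. x (i + k))"

lemma translate_0 [simp]: "translate 0 x = x"
  by (simp add: translate_def)

lemma translate_translate [simp]: "translate k (translate l x) = translate (k + l) x"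
  by (simp add: translate_def algebra_simps)

lemma shift_eq_translate: "shift = translate 1"
  by (rule ext) (simp add: shift_def translate_def)

lemma funpow_shift: "(shift ^^ n) = translate (int n)"
  by (induction n) (auto simp: shift_eq_translate fun_eq_iff translate_def algebra_simps)

lemma continuous_translate: "continuous_on S (translate k :: 'a::topological_space config \<Rightarrow> 'a config)"
  unfolding translate_def
  by (intro continuous_on_coordinatewise_then_product)
    (rule continuous_on_subset[OF continuous_on_product_coordinates subset_UNIV])

lemma agree_translate: "agree (N + d) x y \<Longrightarrow> agree N (translate (int d) x) (translate (int d) y)"
  by (auto simp: agree_def translate_def)

text \<open>Invariance as an equality of sets supplies preimages in \<open>X\<close>, hence closure
  under negative translates as well.\<close>

lemma subshift_iff_translate:
  "subshift X \<longleftrightarrow> closed X \<and> (\<forall>k. \<forall>x\<in>X. translate k x \<in> X)"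
proof
  assume "subshift X"
  then have cl: "closed X" and im: "translate 1 ` X = X"
    by (auto simp: subshift_def shift_eq_translate)
  have up: "translate (int n) x \<in> X" if "x \<in> X" for n x
  proof (induction n)
    case (Suc n)
    from imageI[OF this, of "translate 1"] show ?case by (simp add: im)
  qed (use that in simp)
  have down1: "translate (-1) x \<in> X" if "x \<in> X" for x
  proof -
    from that have "x \<in> translate 1 ` X" by (simp only: im)
    then obtain y where "y \<in> X" "x = translate 1 y" by (rule imageE)
    then show ?thesis by simp
  qed
  have down: "translate (- int n) x \<in> X" if "x \<in> X" for n x
  proof (induction n)
    case (Suc n)
    from down1[OF Suc] show ?case by (simp add: algebra_simps)
  qed (use that in simp)
  have "translate k x \<in> X" if "x \<in> X" for k x
    using up[OF that, of "nat k"] down[OF that, of "nat (- k)"] by (cases "k \<ge> 0") auto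
  with cl show "closed X \<and> (\<forall>k. \<forall>x\<in>X. translate k x \<in> X)" by blast
next
  assume r: "closed X \<and> (\<forall>k. \<forall>x\<in>X. translate k x \<in> X)"
  have "translate 1 ` X = X"
  proof
    show "X \<subseteq> translate 1 ` X"
    proof
      fix x assume "x \<in> X"
      then show "x \<in> translate 1 ` X"
        using r by (intro image_eqI[of x _ "translate (- 1) x"]) auto
    qed
  qed (use r in blast)
  with r show "subshift X" by (simp add: subshift_def shift_eq_translate)
qed

subsection \<open>Chain components\<close>

lemma length_window [simp]: "length (window x i n) = n"
  by (simp add: window_def)

lemma window_translate: "window (translate k x) i n = window x (i + k) n"
  by (simp add: window_def translate_def algebra_simps)

lemma window_eq_iff: "window x i n = window y j n \<longleftrightarrow> (\<forall>k<n. x (i + int k) = y (j + int k))"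
  by (auto simp: window_def)

lemma agree_imp_window_eq: "agree n x y \<Longrightarrow> window x 0 n = window y 0 n"
  by (auto simp: window_eq_iff agree_def)

text \<open>Translation by \<open>N\<close> centres a word of length \<open>2 * N + 1\<close>. This
  links the words of the chain relation to the centred patterns of \<open>agree\<close>.\<close>

lemma window_eq_imp_agree:
  assumes "window x 0 (2 * N + 1) = window y 0 (2 * N + 1)"
  shows "agree N (translate (int N) x) (translate (int N) y)"
  unfolding agree_def
proof (intro allI impI)
  fix i :: int assume i: "\<bar>i\<bar> \<le> int N"
  then have "nat (i + int N) < 2 * N + 1" "int (nat (i + int N)) = i + int N" by linarith+
  with assms have "x (0 + (i + int N)) = y (0 + (i + int N))"
    unfolding window_eq_iff by metis
  then show "translate (int N) x i = translate (int N) y i" by (simp add: translate_def)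
qed

lemma language_n_iff: "u \<in> language_n n X \<longleftrightarrow> (\<exists>x\<in>X. window x 0 n = u)"
  by (auto simp: language_n_def language_def cylinder_def)

lemma language_n_mono: "X \<subseteq> Y \<Longrightarrow> language_n n X \<subseteq> language_n n Y"
  by (auto simp: language_n_iff subset_iff)

text \<open>A word is read off finitely many coordinates, so an open cylinder that meets the closure
  already meets the set.\<close>

lemma language_n_closure:
  fixes U :: "'a::discrete_topology config set"
  shows "language_n n (closure U) = language_n n U"
proof
  show "language_n n (closure U) \<subseteq> language_n n U"
  proof
    fix u assume "u \<in> language_n n (closure U)"
    then obtain x where x: "x \<in> closure U" "window x 0 n = u"
      by (auto simp: language_n_iff)
    have "x \<in> {z. agree n z x} \<inter> closure U" using x(1) by simp
    then have "{z. agree n z x} \<inter> closure U \<noteq> {}" by blast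
    then have "{z. agree n z x} \<inter> U \<noteq> {}"
      by (simp add: open_Int_closure_eq_empty open_agree)
    then obtain y where "y \<in> U" "agree n y x" by auto
    then show "u \<in> language_n n U"
      using x(2) agree_imp_window_eq by (metis language_n_iff)
  qed
qed (rule language_n_mono[OF closure_subset])

lemma pm_chain_rel_subset: "pm_chain_rel n X \<subseteq> language_n n X \<times> language_n n X"
  unfolding pm_chain_rel_def by (rule trancl_subset_Sigma) (auto simp: chain_rel_def)

lemma pm_chain_rel_mono: "X \<subseteq> Y \<Longrightarrow> pm_chain_rel n X \<subseteq> pm_chain_rel n Y"
proof -
  assume "X \<subseteq> Y"
  then have "chain_rel n X \<subseteq> chain_rel n Y"
    using language_n_mono[of X Y n] by (fastforce simp: chain_rel_def)
  then show ?thesis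
    unfolding pm_chain_rel_def by (meson Un_mono converse_mono subsetI trancl_mono)
qed

lemma pm_chain_transitive_iff:
  "pm_chain_transitive X \<longleftrightarrow> (\<forall>n. language_n n X \<times> language_n n X \<subseteq> pm_chain_rel n X)"
  unfolding pm_chain_transitive_def using pm_chain_rel_subset by blast

text \<open>\<open>chain_rel\<close> reads its first word at position 0 and moves only to the right.
  Translating brings the left window to 0, and the converse relation covers
  \<open>j < i\<close>.\<close>

lemma pm_chain_rel_windows:
  assumes "subshift X" "x \<in> X"
  shows "(window x i n, window x j n) \<in> pm_chain_rel n X"
proof -
  have *: "(window x i n, window x j n) \<in> chain_rel n X" if "i \<le> j" for i j
  proof -
    have "translate k x \<in> X" for k using assms by (simp add: subshift_iff_translate)
    moreover have "window (translate i x) 0 n = window x i n"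
      "window (translate j x) 0 n = window x j n"
      "window (translate i x) (int (nat (j - i))) n = window x j n"
      using that by (simp_all add: window_translate)
    ultimately show ?thesis unfolding chain_rel_def language_n_iff by blast
  qed
  show ?thesis
    unfolding pm_chain_rel_def using *[of i j] *[of j i] by (cases "i \<le> j") auto
qed

section \<open>Existence of chain components\<close>

lemma subshift_closure:
  fixes U :: "'a::{finite,discrete_topology} config set"
  assumes "\<And>k x. x \<in> U \<Longrightarrow> translate k x \<in> U"
  shows "subshift (closure U)"
proof -
  have "translate k ` closure U \<subseteq> closure U" for k
    by (rule image_closure_subset[OF continuous_translate closed_closure])
      (use assms closure_subset in blast)
  then show ?thesis by (auto simp: subshift_iff_translate)
qed

text \<open>By \<open>language_n_closure\<close> every word of the orbit closure is a window of
  \<open>x\<close> itself, and the windows of one point are all related.\<close>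

lemma orbit_closure:
  fixes X :: "'a::{finite,discrete_topology} config set"
  assumes "subshift X" "x \<in> X"
  defines "Z \<equiv> closure (range (\<lambda>k. translate k x))"
  shows "subshift Z" "pm_chain_transitive Z" "Z \<subseteq> X" "x \<in> Z"
proof -
  show Z: "subshift Z"
    unfolding Z_def
  proof (rule subshift_closure)
    fix k y assume "y \<in> range (\<lambda>k. translate k x)"
    then obtain l where "y = translate l x" by blast
    then show "translate k y \<in> range (\<lambda>k. translate k x)"
      by (intro range_eqI[of _ _ "k + l"]) simp
  qed
  have "x \<in> range (\<lambda>k. translate k x)" by (rule range_eqI[of _ _ 0]) simp
  then show x: "x \<in> Z" unfolding Z_def by (rule subsetD[OF closure_subset])
  show "Z \<subseteq> X"
    unfolding Z_def
    by (rule closure_minimal) (use assms(1,2) in \<open>auto simp: subshift_iff_translate\<close>)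
  have word: "\<exists>i. u = window x i n" if "u \<in> language_n n Z" for u n
    using that unfolding Z_def language_n_closure by (auto simp: language_n_iff window_translate)
  show "pm_chain_transitive Z"
    unfolding pm_chain_transitive_iff
  proof (intro allI subsetI)
    fix n w assume "w \<in> language_n n Z \<times> language_n n Z"
    then obtain u v where "w = (u, v)" "u \<in> language_n n Z" "v \<in> language_n n Z" by blast
    then show "w \<in> pm_chain_rel n Z"
      using word pm_chain_rel_windows[OF Z x] by metis
  qed
qed

text \<open>Closing the union adds no words, and any two words already occur together in the larger
  of two comparable members, where they are related.\<close>

lemma chain_Union_closure:
  fixes \<C> :: "'a::{finite,discrete_topology} config set set"
  assumes ch: "\<And>Z W. Z \<in> \<C> \<Longrightarrow> W \<in> \<C> \<Longrightarrow> Z \<subseteq> W \<or> W \<subseteq> Z"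
    and sub: "\<And>Z. Z \<in> \<C> \<Longrightarrow> subshift Z" and tr: "\<And>Z. Z \<in> \<C> \<Longrightarrow> pm_chain_transitive Z"
  shows "subshift (closure (\<Union>\<C>))" "pm_chain_transitive (closure (\<Union>\<C>))"
proof -
  show "subshift (closure (\<Union>\<C>))"
    by (rule subshift_closure) (use sub in \<open>auto simp: subshift_iff_translate\<close>)
  have "(u, v) \<in> pm_chain_rel n (closure (\<Union>\<C>))"
    if u: "u \<in> language_n n (closure (\<Union>\<C>))" and v: "v \<in> language_n n (closure (\<Union>\<C>))" for n u v
  proof -
    obtain Z where Z: "Z \<in> \<C>" "u \<in> language_n n Z"
      using u unfolding language_n_closure by (auto simp: language_n_iff)
    obtain W where W: "W \<in> \<C>" "v \<in> language_n n W"
      using v unfolding language_n_closure by (auto simp: language_n_iff)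
    obtain T where T: "T \<in> \<C>" "u \<in> language_n n T" "v \<in> language_n n T"
      using ch[OF Z(1) W(1)] Z W language_n_mono by (metis subsetD)
    then have "(u, v) \<in> pm_chain_rel n T"
      using tr by (auto simp: pm_chain_transitive_iff)
    moreover have "T \<subseteq> closure (\<Union>\<C>)" using T(1) closure_subset[of "\<Union>\<C>"] by (meson Union_upper subset_trans)
    ultimately show ?thesis using pm_chain_rel_mono by (metis subsetD)
  qed
  then show "pm_chain_transitive (closure (\<Union>\<C>))" by (auto simp: pm_chain_transitive_iff)
qed

text \<open>Zorn's lemma on the chain transitive subshifts of \<open>X\<close> through
  \<open>x\<close>: the closure of the union bounds a nonempty chain, and the orbit closure of
  \<open>x\<close> bounds the empty one.\<close>

lemma in_pm_chain_component:
  fixes X :: "'a::{finite,discrete_topology} config set"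
  assumes "subshift X" "x \<in> X"
  obtains C where "C \<in> pm_chain_components X" "x \<in> C"
proof -
  define A where "A = {Z. subshift Z \<and> pm_chain_transitive Z \<and> Z \<subseteq> X \<and> x \<in> Z}"
  have "\<exists>M\<in>A. \<forall>Z\<in>A. M \<subseteq> Z \<longrightarrow> Z = M"
  proof (rule subset_Zorn)
    fix \<C> assume c: "subset.chain A \<C>"
    then have sub: "\<C> \<subseteq> A" and ch: "\<And>Z W. Z \<in> \<C> \<Longrightarrow> W \<in> \<C> \<Longrightarrow> Z \<subseteq> W \<or> W \<subseteq> Z"
      by (auto simp: subset_chain_def)
    show "\<exists>U\<in>A. \<forall>Z\<in>\<C>. Z \<subseteq> U"
    proof (cases "\<C> = {}")
      case True
      moreover have "closure (range (\<lambda>k. translate k x)) \<in> A"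
        using orbit_closure[OF assms] by (simp add: A_def)
      ultimately show ?thesis by blast
    next
      case False
      have "subshift (closure (\<Union>\<C>)) \<and> pm_chain_transitive (closure (\<Union>\<C>))"
        using chain_Union_closure[of \<C>] ch sub by (fastforce simp: A_def)
      moreover have "closure (\<Union>\<C>) \<subseteq> X"
        by (rule closure_minimal) (use sub assms in \<open>auto simp: A_def subshift_def\<close>)
      moreover have "x \<in> closure (\<Union>\<C>)"
        using False sub closure_subset[of "\<Union>\<C>"] by (fastforce simp: A_def)
      ultimately have "closure (\<Union>\<C>) \<in> A" by (simp add: A_def)
      then show ?thesis using closure_subset[of "\<Union>\<C>"] by blast
    qed
  qed
  then obtain M where M: "M \<in> A" "\<And>Z. Z \<in> A \<Longrightarrow> M \<subseteq> Z \<Longrightarrow> Z = M" by blast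
  \<comment> \<open>Maximality among the sets through \<open>x\<close> is maximality outright, since
    every larger subshift still contains \<open>x\<close>.\<close>
  then have "M \<in> pm_chain_components X" "x \<in> M"
    unfolding pm_chain_components_def A_def by auto
  then show ?thesis using that by blast
qed

section \<open>Finiteness of the family of invariant clopen sets\<close>

lemma pm_chain_transitive_subset_invariant:
  fixes X :: "'a::{finite,discrete_topology} config set"
  assumes C: "subshift C" "pm_chain_transitive C" "C \<subseteq> X" and X: "subshift X"
    and D: "D \<subseteq> X" "closed D" "closed (X - D)"
    and inv: "\<And>x. x \<in> X \<Longrightarrow> shift x \<in> D \<longleftrightarrow> x \<in> D"
    and x: "x \<in> C" "x \<in> D"
  shows "C \<subseteq> D"
proof
  fix y assume y: "y \<in> C"
  obtain N where N: "\<And>x y. x \<in> X \<Longrightarrow> y \<in> X \<Longrightarrow> agree N x y \<Longrightarrow> x \<in> D \<longleftrightarrow> y \<in> D"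
    using clopen_imp_local[OF D] by metis
  define n where "n = 2 * N + 1"
  have tX: "translate k z \<in> X" if "z \<in> X" for z k using X that by (simp add: subshift_iff_translate)
  have inv': "translate (int k) z \<in> D \<longleftrightarrow> z \<in> D" if "z \<in> X" for z k
  proof (induction k)
    case (Suc k)
    have "translate (int (Suc k)) z = shift (translate (int k) z)"
      by (simp add: shift_eq_translate)
    then show ?case using Suc inv[OF tX[OF that]] by simp
  qed simp
  have word: "z \<in> D \<longleftrightarrow> z' \<in> D" if "z \<in> X" "z' \<in> X" "window z 0 n = window z' 0 n" for z z'
    using N[OF tX[OF that(1)] tX[OF that(2)] window_eq_imp_agree] that inv' by (simp add: n_def)
  \<comment> \<open>Membership in \<open>D\<close> becomes a property of words of length
    \<open>n\<close>. As the shift preserves membership, this property cannot change along a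
    chain.\<close>
  define Q where "Q u \<longleftrightarrow> (\<forall>z\<in>X. window z 0 n = u \<longrightarrow> z \<in> D)" for u
  have QI: "Q (window z 0 n) \<longleftrightarrow> z \<in> D" if "z \<in> X" for z
    unfolding Q_def using word that by metis
  have rel: "Q u \<longleftrightarrow> Q v" if "(u, v) \<in> chain_rel n C" for u v
  proof -
    obtain z k where "z \<in> C" "window z 0 n = u" "window z (int k) n = v"
      using \<open>(u, v) \<in> chain_rel n C\<close> by (auto simp: chain_rel_def)
    moreover have "window z (int k) n = window (translate (int k) z) 0 n"
      by (simp add: window_translate)
    ultimately show ?thesis using QI inv' tX C(3) by (metis subsetD)
  qed
  have "(window x 0 n, window y 0 n) \<in> pm_chain_rel n C"
    using C(2) x y unfolding pm_chain_transitive_iff by (blast intro: language_n_iff[THEN iffD2])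
  then have "Q (window x 0 n) \<longleftrightarrow> Q (window y 0 n)"
    unfolding pm_chain_rel_def by (induction rule: trancl_induct) (auto simp: rel)
  then show "y \<in> D" using QI x y C(3) by blast
qed

text \<open>Closedness of both \<open>E\<close> and \<open>X - E\<close> makes \<open>E\<close>
  clopen relative to \<open>X\<close>. Invariance is asked of the p-th power only, because the shift
  itself may permute the fibres of a factor.\<close>

definition invariant_clopens :: "nat \<Rightarrow> 'a::{finite,discrete_topology} config set \<Rightarrow> 'a config set set" where
  "invariant_clopens p X = {E. E \<subseteq> X \<and> closed E \<and> closed (X - E) \<and>
     (\<forall>x\<in>X. translate (int p) x \<in> E \<longleftrightarrow> x \<in> E)}"

lemma finite_invariant_clopens:
  fixes X :: "'a::{finite,discrete_topology} config set"
  assumes X: "subshift X" and fin: "finite (pm_chain_components X)" and p: "p > 0"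
  shows "finite (invariant_clopens p X)"
proof -
  define B where "B = invariant_clopens p X"
  \<comment> \<open>One point per component and its first \<open>p\<close> translates already meet every nonempty member:
      the union of the translates of a member is shift-invariant, hence contains a whole component.\<close>
  define P where "P = (\<lambda>(C, j). translate (int j) (SOME x. x \<in> C)) ` (pm_chain_components X \<times> {..<p})"
  have "finite P" unfolding P_def using fin by auto
  have clX: "closed X" and tX: "\<And>x k. x \<in> X \<Longrightarrow> translate k x \<in> X"
    using X by (auto simp: subshift_iff_translate)
  have hit: "E \<inter> P \<noteq> {}" if E: "E \<in> B" "E \<noteq> {}" for E
  proof -
    have E': "E \<subseteq> X" "closed E" "closed (X - E)"
      "\<And>x. x \<in> X \<Longrightarrow> translate (int p) x \<in> E \<longleftrightarrow> x \<in> E"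
      using E by (auto simp: B_def invariant_clopens_def)
    define D where "D = {x \<in> X. \<exists>j<p. translate (int j) x \<in> E}"
    have "D = X \<inter> (\<Union>j\<in>{..<p}. translate (int j) -` E)" by (auto simp: D_def)
    moreover have "closed (\<Union>j\<in>{..<p}. translate (int j) -` E)"
      by (intro closed_UN finite_lessThan ballI closed_vimage E'(2) continuous_translate)
    ultimately have clD: "closed D" using clX by auto
    have "X - D = X \<inter> (\<Inter>j\<in>{..<p}. translate (int j) -` (X - E))" using tX by (auto simp: D_def)
    moreover have "closed (\<Inter>j\<in>{..<p}. translate (int j) -` (X - E))"
      by (intro closed_INT ballI closed_vimage E'(3) continuous_translate)
    ultimately have clXD: "closed (X - D)" using clX by auto
    have inv: "shift x \<in> D \<longleftrightarrow> x \<in> D" if "x \<in> X" for x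
    proof -
      have *: "translate (int j) (shift x) = translate (int (Suc j)) x" for j
        by (simp add: shift_eq_translate algebra_simps)
      \<comment> \<open>Raising the index by one permutes the residues modulo \<open>p\<close>. Only
        the ends \<open>Suc j = p\<close> and \<open>j = 0\<close> wrap around, by the invariance of
        \<open>E\<close> under translation by \<open>p\<close>.\<close>
      have "(\<exists>j<p. translate (int (Suc j)) x \<in> E) \<longleftrightarrow> (\<exists>j<p. translate (int j) x \<in> E)"
      proof
        assume "\<exists>j<p. translate (int (Suc j)) x \<in> E"
        then obtain j where j: "j < p" "translate (int (Suc j)) x \<in> E" by blast
        show "\<exists>j<p. translate (int j) x \<in> E"
        proof (cases "Suc j = p")
          case True
          with j(2) have "translate (int 0) x \<in> E" using E'(4)[OF that] by simp
          then show ?thesis using p by blast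
        qed (use j in \<open>auto intro: exI[of _ "Suc j"]\<close>)
      next
        assume "\<exists>j<p. translate (int j) x \<in> E"
        then obtain j where j: "j < p" "translate (int j) x \<in> E" by blast
        show "\<exists>j<p. translate (int (Suc j)) x \<in> E"
        proof (cases j)
          case 0
          with j(2) have "translate (int (Suc (p - 1))) x \<in> E" using E'(4)[OF that] p by simp
          then show ?thesis using p by (metis diff_less less_numeral_extra(1))
        next
          case (Suc i)
          then show ?thesis using j by (metis Suc_lessD)
        qed
      qed
      moreover have "shift x \<in> X" using tX[OF that] by (simp add: shift_eq_translate)
      ultimately show ?thesis using that unfolding D_def * mem_Collect_eq by blast
    qed
    obtain e where e: "e \<in> E" using E by blast
    with p have "e \<in> D" using E'(1) by (auto simp: D_def intro: exI[of _ 0])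
    obtain C where C: "C \<in> pm_chain_components X" "e \<in> C"
      using in_pm_chain_component[OF X] e E'(1) by blast
    have "C \<subseteq> D"
      by (rule pm_chain_transitive_subset_invariant[OF _ _ _ X _ clD clXD inv C(2) \<open>e \<in> D\<close>])
        (use C(1) in \<open>auto simp: pm_chain_components_def D_def\<close>)
    moreover have "(SOME x. x \<in> C) \<in> C" using C(2) by (metis someI)
    ultimately have "(SOME x. x \<in> C) \<in> D" by blast
    then obtain j where "j < p" "translate (int j) (SOME x. x \<in> C) \<in> E" by (auto simp: D_def)
    then show ?thesis using C(1) unfolding P_def by force
  qed
  \<comment> \<open>If two members have the same trace on \<open>P\<close>, both of their
    differences are members that miss \<open>P\<close>, hence are empty.\<close>
  have "inj_on (\<lambda>E. E \<inter> P) B"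
  proof (rule inj_onI)
    fix E F assume EF: "E \<in> B" "F \<in> B" "E \<inter> P = F \<inter> P"
    have diff: "E - F \<in> B" if "E \<in> B" "F \<in> B" for E F
    proof -
      have "E - F = E \<inter> (X - F)" "X - (E - F) = (X - E) \<union> (X \<inter> F)"
        using that by (auto simp: B_def invariant_clopens_def)
      then show ?thesis using that clX by (auto simp: B_def invariant_clopens_def)
    qed
    have "E - F = {}" "F - E = {}"
      using hit[OF diff[OF EF(1,2)]] hit[OF diff[OF EF(2,1)]] EF(3) by blast+
    then show "E = F" by blast
  qed
  moreover have "finite ((\<lambda>E. E \<inter> P) ` B)"
    by (rule finite_subset[of _ "Pow P"]) (use \<open>finite P\<close> in auto)
  ultimately show ?thesis unfolding B_def using finite_imageD by blast
qed

subsection \<open>Generic behaviour\<close>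

lemma comeager_mono: "comeager S \<Longrightarrow> S \<subseteq> T \<Longrightarrow> comeager T"
  unfolding comeager_def by (meson subset_trans)

lemma comeager_UNIV: "comeager UNIV"
  unfolding comeager_def by (intro exI[of _ "{}"]) auto

lemma comeager_Int:
  assumes "comeager S" "comeager T"
  shows "comeager (S \<inter> T)"
proof -
  obtain G H where "countable G" "\<forall>U\<in>G. open U \<and> closure U = UNIV" "\<Inter>G \<subseteq> S"
    and "countable H" "\<forall>U\<in>H. open U \<and> closure U = UNIV" "\<Inter>H \<subseteq> T"
    using assms unfolding comeager_def by metis
  then show ?thesis
    unfolding comeager_def by (intro exI[of _ "G \<union> H"]) auto
qed

lemma comeager_INT_finite:
  "finite I \<Longrightarrow> (\<And>i. i \<in> I \<Longrightarrow> comeager (S i)) \<Longrightarrow> comeager (\<Inter>i\<in>I. S i)"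
  by (induction I rule: finite_induct) (auto simp: comeager_UNIV intro: comeager_Int)

text \<open>The boundary of a closed set is nowhere dense, so discarding the countably many
  boundaries of the \<open>L t\<close> keeps the set comeager. A remaining point of
  \<open>L t\<close> is interior to it.\<close>

lemma comeager_UN_interior:
  fixes L :: "nat \<Rightarrow> 'a::topological_space set"
  assumes "comeager (\<Union>t. L t)" and cl: "\<And>t. closed (L t)"
  shows "comeager (\<Union>t. interior (L t))"
proof -
  obtain G where G: "countable G" "\<And>U. U \<in> G \<Longrightarrow> open U \<and> closure U = UNIV" "\<Inter>G \<subseteq> (\<Union>t. L t)"
    using assms(1) unfolding comeager_def by metis
  let ?H = "\<lambda>t. - (L t - interior (L t))"
  have "open (?H t) \<and> closure (?H t) = UNIV" for t
  proof
    have "- (L t - interior (L t)) = - L t \<union> interior (L t)" by auto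
    then show "open (?H t)" using cl[of t] by (simp add: open_Un open_Compl)
    have "interior (L t - interior (L t)) \<subseteq> interior (L t)"
      by (intro interior_mono) auto
    moreover have "interior (L t - interior (L t)) \<subseteq> L t - interior (L t)"
      by (rule interior_subset)
    ultimately have "interior (L t - interior (L t)) = {}" by blast
    then show "closure (?H t) = UNIV" by (simp only: closure_complement) simp
  qed
  then have "comeager (\<Inter>(G \<union> range ?H))"
    unfolding comeager_def using G(1,2) by (intro exI[of _ "G \<union> range ?H"]) blast
  then show ?thesis
  proof (rule comeager_mono, intro subsetI)
    fix x assume x: "x \<in> \<Inter>(G \<union> range ?H)"
    then obtain t where "x \<in> L t" using G(3) by blast
    moreover have "x \<in> ?H t" using x by blast
    ultimately show "x \<in> (\<Union>t. interior (L t))" by blast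
  qed
qed

text \<open>The Baire category theorem, which applies because the full shift is compact and
  Hausdorff.\<close>

lemma comeager_meets_open:
  fixes S W :: "'a::{finite,discrete_topology} config set"
  assumes "comeager S" "open W" "W \<noteq> {}"
  shows "W \<inter> S \<noteq> {}"
proof -
  obtain G where G: "countable G" "\<And>U. U \<in> G \<Longrightarrow> open U \<and> closure U = UNIV" "\<Inter>G \<subseteq> S"
    using assms(1) unfolding comeager_def by metis
  have comp: "compact_space (euclidean :: 'a config topology)"
    using compact_config by (simp add: compact_space_def)
  have haus: "Hausdorff_space (euclidean :: 'a config topology)"
    unfolding Hausdorff_space_def
  proof (intro allI impI)
    fix x y :: "'a config"
    assume "x \<in> topspace euclidean \<and> y \<in> topspace euclidean \<and> x \<noteq> y"
    then obtain i where "x i \<noteq> y i" by (auto simp: fun_eq_iff)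
    then show "\<exists>U V. openin euclidean U \<and> openin euclidean V \<and> x \<in> U \<and> y \<in> V \<and> disjnt U V"
      using open_coordinate[of i "{x i}"] open_coordinate[of i "- {x i}"]
      by (intro exI[of _ "{z. z i \<in> {x i}}"] exI[of _ "{z. z i \<in> - {x i}}"])
        (auto simp: disjnt_def)
  qed
  have "euclidean closure_of \<Inter>G = topspace (euclidean :: 'a config topology)"
    by (rule Baire_category)
      (use comp haus G in \<open>auto simp: compact_imp_locally_compact_space compact_Hausdorff_imp_regular_space\<close>)
  then have "closure (\<Inter>G) = UNIV" by simp
  then have "W \<inter> closure (\<Inter>G) \<noteq> {}" using assms(3) by simp
  then have "W \<inter> \<Inter>G \<noteq> {}" using open_Int_closure_eq_empty[OF assms(2)] by metis
  then show ?thesis using G(3) by blast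
qed

section \<open>Generic orbits and the generic limit set\<close>

lemma eventually_near_omega_limit:
  fixes x :: "'a::{finite,discrete_topology} config"
  assumes "open U" "omega_limit f x \<subseteq> U"
  shows "eventually (\<lambda>t. (f ^^ t) x \<in> U) sequentially"
proof (rule ccontr)
  assume "\<not> ?thesis"
  then have "infinite {t. (f ^^ t) x \<notin> U}"
    unfolding eventually_sequentially infinite_nat_iff_unbounded_le by blast
  then obtain r :: "nat \<Rightarrow> nat" where r: "strict_mono r" "\<And>n. (f ^^ r n) x \<notin> U"
    using infinite_enumerate by blast
  \<comment> \<open>The infinitely many visits outside \<open>U\<close> accumulate in the compact
    set \<open>- U\<close>, at a point of the limit set.\<close>
  have "closed (- U)" using assms(1) by (rule closed_Compl)
  from compact_imp_seq_compact[OF closed_imp_compact_config[OF this]] r(2)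
  obtain l s where l: "l \<in> - U" "strict_mono s" "((\<lambda>n. (f ^^ r n) x) \<circ> s) \<longlonglongrightarrow> l"
    unfolding seq_compact_def by (metis ComplI)
  then have "l \<in> omega_limit f x"
    using strict_mono_o[OF r(1) l(2)] by (auto simp: omega_limit_def o_def intro: exI[of _ "r \<circ> s"])
  then show False using l(1) assms(2) by blast
qed

text \<open>The generic limit set may be an intersection of uncountably many closed sets. Since the
  complement of \<open>nbhd\<close> is compact, finitely many of them already intersect inside
  \<open>nbhd\<close>, and finitely many comeager realms may be intersected.\<close>

lemma comeager_eventually_nbhd:
  fixes f :: "'a::{finite,discrete_topology} config \<Rightarrow> 'a config"
  shows "comeager {x. eventually (\<lambda>t. (f ^^ t) x \<in> nbhd M (generic_limit_set f)) sequentially}"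
proof -
  let ?U = "nbhd M (generic_limit_set f)"
  define \<C> where "\<C> = {C. closed C \<and> comeager (realm f C)}"
  have sub: "\<Inter>\<C> \<subseteq> ?U"
    using subset_nbhd by (auto simp: generic_limit_set_def \<C>_def)
  have comp: "compact (- ?U)"
    by (intro closed_imp_compact_config closed_Compl open_nbhd)
  have cover: "- ?U \<subseteq> (\<Union>C\<in>\<C>. - C)" using sub by blast
  obtain \<F> where F: "\<F> \<subseteq> \<C>" "finite \<F>" "- ?U \<subseteq> (\<Union>C\<in>\<F>. - C)"
    by (rule compactE_image[OF comp _ cover]) (auto simp: \<C>_def)
  have "comeager (\<Inter>C\<in>\<F>. realm f C)"
    using F by (intro comeager_INT_finite) (auto simp: \<C>_def)
  then show ?thesis
  proof (rule comeager_mono)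
    show "(\<Inter>C\<in>\<F>. realm f C) \<subseteq> {x. eventually (\<lambda>t. (f ^^ t) x \<in> ?U) sequentially}"
    proof
      fix x assume "x \<in> (\<Inter>C\<in>\<F>. realm f C)"
      then have "omega_limit f x \<subseteq> ?U" using F(3) by (fastforce simp: realm_def)
      then show "x \<in> {x. eventually (\<lambda>t. (f ^^ t) x \<in> ?U) sequentially}"
        using eventually_near_omega_limit[OF open_nbhd] by blast
    qed
  qed
qed

text \<open>Otherwise \<open>- V\<close> would be one of the closed sets whose intersection is the
  generic limit set.\<close>

lemma not_comeager_eventually_avoiding:
  assumes "open V" "V \<inter> generic_limit_set f \<noteq> {}"
  shows "\<not> comeager {x. eventually (\<lambda>t. (f ^^ t) x \<notin> V) sequentially}"
proof
  assume "comeager {x. eventually (\<lambda>t. (f ^^ t) x \<notin> V) sequentially}"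
  then have "comeager (realm f (- V))"
  proof (rule comeager_mono, intro subsetI)
    fix x assume x: "x \<in> {x. eventually (\<lambda>t. (f ^^ t) x \<notin> V) sequentially}"
    have "y \<notin> V" if y: "y \<in> omega_limit f x" for y
    proof
      assume "y \<in> V"
      obtain r :: "nat \<Rightarrow> nat" where r: "strict_mono r" "(\<lambda>n. (f ^^ r n) x) \<longlonglongrightarrow> y"
        using y unfolding omega_limit_def by blast
      have "eventually (\<lambda>n. (f ^^ r n) x \<in> V) sequentially"
        using topological_tendstoD[OF r(2) assms(1) \<open>y \<in> V\<close>] .
      moreover have "eventually (\<lambda>n. (f ^^ r n) x \<notin> V) sequentially"
        using x eventually_subseq[OF r(1)] by simp
      ultimately have "eventually (\<lambda>n. False) sequentially"
        by eventually_elim simp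
      then show False by simp
    qed
    then show "x \<in> realm f (- V)" by (auto simp: realm_def)
  qed
  then have "generic_limit_set f \<subseteq> - V"
    using assms(1) unfolding generic_limit_set_def by (intro Inter_lower) auto
  then show False using assms(2) by blast
qed

lemma closed_generic_limit_set: "closed (generic_limit_set f)"
  unfolding generic_limit_set_def by (intro closed_Inter) auto

lemma notin_closed_imp_notin_nbhd:
  fixes X :: "'a::discrete_topology config set"
  assumes "closed X" "y \<notin> X"
  obtains M where "y \<notin> nbhd M X"
proof -
  obtain M where "{z. agree M z y} \<subseteq> - X"
    using agree_basis[of "- X" y] assms by (auto simp: open_Compl)
  then have "y \<notin> nbhd M X" by (auto simp: nbhd_def dest: agree_sym)
  then show ?thesis using that by blast
qed

text \<open>If \<open>f y\<close> left the limit set, the open set \<open>V\<close> of points with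
  image outside a clopen neighbourhood would contain \<open>y\<close>, although generic orbits
  eventually stay in that neighbourhood and so avoid \<open>V\<close>.\<close>

lemma generic_limit_set_forward_invariant:
  fixes f :: "'a::{finite,discrete_topology} config \<Rightarrow> 'a config"
  assumes "continuous_on UNIV f" "y \<in> generic_limit_set f"
  shows "f y \<in> generic_limit_set f"
proof (rule ccontr)
  assume "f y \<notin> generic_limit_set f"
  then obtain M where M: "f y \<notin> nbhd M (generic_limit_set f)"
    using notin_closed_imp_notin_nbhd[OF closed_generic_limit_set] by metis
  define V where "V = f -` (- nbhd M (generic_limit_set f))"
  have "open V"
    unfolding V_def by (rule open_vimage[OF _ assms(1)]) (simp add: closed_nbhd open_Compl)
  moreover have "V \<inter> generic_limit_set f \<noteq> {}" using assms(2) M by (auto simp: V_def)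
  moreover have "comeager {x. eventually (\<lambda>t. (f ^^ t) x \<notin> V) sequentially}"
  proof (rule comeager_mono[OF comeager_eventually_nbhd], intro subsetI CollectI)
    fix x assume "x \<in> {x. eventually (\<lambda>t. (f ^^ t) x \<in> nbhd M (generic_limit_set f)) sequentially}"
    then have "eventually (\<lambda>t. (f ^^ Suc t) x \<in> nbhd M (generic_limit_set f)) sequentially"
      unfolding mem_Collect_eq by (rule eventually_sequentially_Suc[THEN iffD2])
    then show "eventually (\<lambda>t. (f ^^ t) x \<notin> V) sequentially"
      by eventually_elim (simp add: V_def)
  qed
  ultimately show False using not_comeager_eventually_avoiding by blast
qed

subsection \<open>Evolution of states\<close>

lemma clopen_family_imp_local:
  fixes X :: "'a::{finite,discrete_topology} config set"
  assumes "finite B" and "\<And>E. E \<in> B \<Longrightarrow> E \<subseteq> X \<and> closed E \<and> closed (X - E)"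
  obtains N where "\<And>E x y. E \<in> B \<Longrightarrow> x \<in> X \<Longrightarrow> y \<in> X \<Longrightarrow> agree N x y \<Longrightarrow> x \<in> E \<longleftrightarrow> y \<in> E"
proof -
  have "\<exists>n. \<forall>x\<in>X. \<forall>y\<in>X. agree n x y \<longrightarrow> (x \<in> E \<longleftrightarrow> y \<in> E)" if "E \<in> B" for E
    using clopen_imp_local[of E X] assms(2)[OF that] by metis
  then obtain n where n: "\<And>E x y. E \<in> B \<Longrightarrow> x \<in> X \<Longrightarrow> y \<in> X \<Longrightarrow> agree (n E) x y \<Longrightarrow> x \<in> E \<longleftrightarrow> y \<in> E"
    by metis
  have "n E \<le> Max (insert 0 (n ` B))" if "E \<in> B" for E
    using that assms(1) by (intro Max_ge) auto
  then show ?thesis using that[of "Max (insert 0 (n ` B))"] n agree_mono by metis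
qed

text \<open>By the pigeonhole principle two powers of \<open>g\<close> agree on \<open>Y\<close>,
  and the smaller one cancels because it is onto.\<close>

lemma surj_on_finite_funpow_eq_id:
  assumes "finite Y" "g ` Y = Y"
  obtains p :: nat where "p > 0" "\<And>y. y \<in> Y \<Longrightarrow> (g ^^ p) y = y"
proof -
  have im: "(g ^^ n) ` Y = Y" for n
  proof (induction n)
    case (Suc n)
    have "(g ^^ Suc n) ` Y = g ` (g ^^ n) ` Y" by (simp add: image_comp)
    then show ?case by (simp only: Suc assms(2))
  qed simp
  \<comment> \<open>Restriction makes the powers extensional, so that they lie in a finite function
    space.\<close>
  define h where "h n = restrict (g ^^ n) Y" for n
  have "h n \<in> Y \<rightarrow>\<^sub>E Y" for n
    unfolding h_def restrict_PiE_iff using im[of n] by (metis imageI)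
  then have "range h \<subseteq> Y \<rightarrow>\<^sub>E Y" by blast
  then have "finite (range h)" by (rule finite_subset) (intro finite_PiE assms(1))
  then have "\<not> inj h" using finite_imageD by blast
  then obtain m n where "m < n" "h m = h n" by (metis injI linorder_neqE_nat)
  have "(g ^^ (n - m)) y = y" if "y \<in> Y" for y
  proof -
    have "y \<in> (g ^^ m) ` Y" using im that by simp
    then obtain z where z: "z \<in> Y" "y = (g ^^ m) z" by blast
    have "(g ^^ (n - m)) y = (g ^^ n) z"
      using \<open>m < n\<close> by (simp add: z(2) funpow_add[symmetric, unfolded o_def, THEN fun_cong])
    also have "\<dots> = y" using \<open>h m = h n\<close> z by (metis h_def restrict_apply')
    finally show ?thesis .
  qed
  then show ?thesis using that[of "n - m"] \<open>m < n\<close> by simp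
qed

text \<open>Mixing of the full shift: for \<open>d > 2 * M\<close> the windows of radius
  \<open>M\<close> about 0 and about \<open>d\<close> are disjoint, so the central pattern of
  \<open>x\<close> can be placed in both.\<close>

lemma open_translate_meets:
  fixes U :: "'a::discrete_topology config set"
  assumes "open U" "x \<in> U"
  obtains M where "\<And>d. d > 2 * M \<Longrightarrow> U \<inter> translate (int d) -` U \<noteq> {}"
proof -
  obtain M where M: "{z. agree M z x} \<subseteq> U" using agree_basis[OF assms] .
  have "U \<inter> translate (int d) -` U \<noteq> {}" if "d > 2 * M" for d
  proof -
    define z where "z i = (if i \<le> int M then x i else x (i - int d))" for i
    have "agree M z x" by (auto simp: agree_def z_def)
    moreover have "agree M (translate (int d) z) x"
      using that by (auto simp: agree_def z_def translate_def)
    ultimately show ?thesis using M by blast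
  qed
  then show ?thesis using that by blast
qed

lemma funpow_translate_commute:
  fixes f :: "'a config \<Rightarrow> 'a config"
  assumes "f \<circ> shift = shift \<circ> f"
  shows "(f ^^ t) (translate (int d) x) = translate (int d) ((f ^^ t) x)"
proof -
  have 1: "f (shift x) = shift (f x)" for x using assms by (metis comp_apply)
  have 2: "f ((shift ^^ d) x) = (shift ^^ d) (f x)" for x
    by (induction d) (simp_all add: 1)
  have "(f ^^ t) ((shift ^^ d) x) = (shift ^^ d) ((f ^^ t) x)"
  proof (induction t)
    case (Suc t)
    have "(f ^^ Suc t) ((shift ^^ d) x) = f ((shift ^^ d) ((f ^^ t) x))"
      by (simp add: Suc)
    also have "\<dots> = (shift ^^ d) ((f ^^ Suc t) x)" by (simp add: 2)
    finally show ?case .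
  qed simp
  then show ?thesis by (simp add: funpow_shift)
qed

text \<open>Closes the finite family under \<open>f\<close>: for a point of \<open>X\<close>, the
  members that contain it determine the members that contain its image.\<close>

lemma preimage_invariant_clopens:
  fixes f :: "'a::{finite,discrete_topology} config \<Rightarrow> 'a config"
  assumes "continuous_on UNIV f" "f \<circ> shift = shift \<circ> f"
    and X: "subshift X" "\<And>x. x \<in> X \<Longrightarrow> f x \<in> X" and E: "E \<in> invariant_clopens p X"
  shows "X \<inter> f -` E \<in> invariant_clopens p X"
proof -
  have E': "closed E" "closed (X - E)" "\<And>x. x \<in> X \<Longrightarrow> translate (int p) x \<in> E \<longleftrightarrow> x \<in> E"
    using E by (auto simp: invariant_clopens_def)
  have clX: "closed X" and tX: "\<And>x k. x \<in> X \<Longrightarrow> translate k x \<in> X"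
    using X(1) by (auto simp: subshift_iff_translate)
  have "closed (X \<inter> f -` E)"
    by (intro closed_Int clX closed_vimage E'(1) assms(1))
  moreover have "X - X \<inter> f -` E = X \<inter> f -` (X - E)" using X(2) by auto
  moreover have "closed (X \<inter> f -` (X - E))"
    by (intro closed_Int clX closed_vimage E'(2) assms(1))
  moreover have "f (translate (int p) x) = translate (int p) (f x)" for x
    using funpow_translate_commute[OF assms(2), of 1] by simp
  then have "translate (int p) x \<in> X \<inter> f -` E \<longleftrightarrow> x \<in> X \<inter> f -` E" if "x \<in> X" for x
    using E'(3)[OF X(2)[OF that]] tX that by simp
  ultimately show ?thesis unfolding invariant_clopens_def by simp
qed

lemma continuous_on_funpow:
  fixes f :: "'b::topological_space \<Rightarrow> 'b"
  assumes "continuous_on UNIV f"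
  shows "continuous_on UNIV (f ^^ t)"
proof (induction t)
  case (Suc t)
  then have "continuous_on UNIV (f \<circ> (f ^^ t))"
    by (rule continuous_on_compose) (rule continuous_on_subset[OF assms subset_UNIV])
  then show ?case by simp
qed (simp add: id_def)

text \<open>All points of \<open>W\<close> visit the set at the same times. Their orbits may differ;
  what coincides is their state, the collection \<open>S\<close> of members of \<open>B\<close>
  selected by the window [-N, N].\<close>

lemma uniformly_recurrent_clopen:
  fixes f :: "'a::{finite,discrete_topology} config \<Rightarrow> 'a config"
  assumes cont: "continuous_on UNIV f" and X: "X = generic_limit_set f"
    and fin: "finite B" and clopen: "\<And>E. E \<in> B \<Longrightarrow> E \<subseteq> X \<and> closed E \<and> closed (X - E)"
    and pre: "\<And>E. E \<in> B \<Longrightarrow> X \<inter> f -` E \<in> B"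
    and E0: "E0 \<in> B" "E0 \<noteq> {}"
  obtains N W where "open W" "W \<noteq> {}"
    "\<exists>\<^sub>F t in sequentially. \<forall>x\<in>W. (f ^^ t) x \<in> nbhd N E0"
    "\<And>z y. y \<in> X \<Longrightarrow> agree N z y \<Longrightarrow> z \<in> nbhd N E0 \<longleftrightarrow> y \<in> E0"
proof -
  obtain N where N: "\<And>E x y. E \<in> B \<Longrightarrow> x \<in> X \<Longrightarrow> y \<in> X \<Longrightarrow> agree N x y \<Longrightarrow> x \<in> E \<longleftrightarrow> y \<in> E"
    using clopen_family_imp_local[OF fin clopen] by metis
  have loc: "z \<in> nbhd N E \<longleftrightarrow> y \<in> E" if "E \<in> B" "y \<in> X" "agree N z y" for E z y
  proof
    assume "z \<in> nbhd N E"
    then obtain y' where y': "y' \<in> E" "agree N z y'" by (auto simp: nbhd_def)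
    then have "agree N y y'" using that(3) by (meson agree_sym agree_trans)
    then show "y \<in> E" using N[OF that(1,2)] y'(1) clopen[OF that(1)] by blast
  qed (use that in \<open>auto simp: nbhd_def\<close>)
  obtain M0 where M0: "\<And>x y. agree M0 x y \<Longrightarrow> agree N (f x) (f y)"
    using continuous_imp_local[OF cont] by metis
  \<comment> \<open>Radius \<open>N\<close> compares \<open>z\<close> with a point of
    \<open>X\<close>, and radius \<open>M0\<close> does the same for their images under
    \<open>f\<close>.\<close>
  define M where "M = max N M0"
  have fX: "f y \<in> X" if "y \<in> X" for y
    using generic_limit_set_forward_invariant[OF cont] that X by simp
  have step: "f z \<in> nbhd N E \<longleftrightarrow> z \<in> nbhd N (X \<inter> f -` E)" if "z \<in> nbhd M X" "E \<in> B" for z E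
  proof -
    obtain y where y: "y \<in> X" "agree M z y" using \<open>z \<in> nbhd M X\<close> by (auto simp: nbhd_def)
    then have "agree N z y" "agree N (f z) (f y)"
      using M0 agree_mono[OF y(2)] by (auto simp: M_def)
    then show ?thesis
      using loc[OF \<open>E \<in> B\<close> fX[OF y(1)]] loc[OF pre[OF \<open>E \<in> B\<close>] y(1)] y(1) by simp
  qed
  define S where "S z = {E \<in> B. z \<in> nbhd N E}" for z
  \<comment> \<open>By \<open>step\<close>, \<open>E\<close> belongs to \<open>S (f z)\<close>
    exactly if \<open>X \<inter> f -\<close> followed by \<open>E\<close>, again a member of
    \<open>B\<close>, belongs to \<open>S z\<close>. So one state determines the next at legal
    points.\<close>
  have S_step: "S (f z) = S (f z')" if "z \<in> nbhd M X" "z' \<in> nbhd M X" "S z = S z'" for z z'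
  proof -
    have "z \<in> nbhd N E \<longleftrightarrow> z' \<in> nbhd N E" if "E \<in> B" for E
      using that \<open>S z = S z'\<close> by (auto simp: S_def)
    then show ?thesis using step[OF that(1)] step[OF that(2)] pre by (auto simp: S_def)
  qed
  have S_agree: "S z = S z'" if "agree N z z'" for z z'
  proof -
    have "z \<in> nbhd N E \<longleftrightarrow> z' \<in> nbhd N E" for E
      using that unfolding nbhd_def mem_Collect_eq by (meson agree_sym agree_trans)
    then show ?thesis by (simp add: S_def)
  qed
  define L where "L T = {x. \<forall>t\<ge>T. (f ^^ t) x \<in> nbhd M X}" for T
  have "(\<Union>T. L T) = {x. eventually (\<lambda>t. (f ^^ t) x \<in> nbhd M X) sequentially}"
    by (auto simp: L_def eventually_sequentially)
  then have "comeager (\<Union>T. L T)"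
    using comeager_eventually_nbhd[of f M] X by simp
  moreover have "closed (L T)" for T
  proof -
    have "L T = (\<Inter>t\<in>{T..}. (f ^^ t) -` nbhd M X)" by (auto simp: L_def)
    also have "closed \<dots>"
      by (intro closed_INT ballI closed_vimage closed_nbhd continuous_on_funpow cont)
    finally show ?thesis .
  qed
  ultimately have int: "comeager (\<Union>T. interior (L T))" by (rule comeager_UN_interior)
  \<comment> \<open>Otherwise every point interior to some \<open>L T\<close> would eventually avoid
    \<open>nbhd N E0\<close>. Such points are generic, while this open set meets
    \<open>X\<close>.\<close>
  have "\<exists>W T x. open W \<and> x \<in> W \<and> W \<subseteq> L T \<and> (\<forall>y\<in>W. S ((f ^^ T) y) = S ((f ^^ T) x)) \<and>
      \<not> eventually (\<lambda>t. (f ^^ t) x \<notin> nbhd N E0) sequentially"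
  proof (rule ccontr)
    assume neg: "\<not> ?thesis"
    have avoid: "comeager {x. eventually (\<lambda>t. (f ^^ t) x \<notin> nbhd N E0) sequentially}"
    proof (rule comeager_mono[OF int], intro subsetI CollectI)
      fix x assume "x \<in> (\<Union>T. interior (L T))"
      then obtain T where T: "x \<in> interior (L T)" by blast
      \<comment> \<open>Points of \<open>W\<close> show the same pattern as \<open>x\<close> on
        [-N, N] at time \<open>T\<close>, hence have the same state then.\<close>
      define W where "W = interior (L T) \<inter> (f ^^ T) -` {z. agree N z ((f ^^ T) x)}"
      have "open W"
        unfolding W_def
        by (intro open_Int open_interior open_vimage open_agree continuous_on_funpow cont)
      moreover have "x \<in> W" "W \<subseteq> L T" using T interior_subset[of "L T"] by (auto simp: W_def)
      moreover have "\<forall>y\<in>W. S ((f ^^ T) y) = S ((f ^^ T) x)" by (auto simp: W_def intro!: S_agree)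
      ultimately show "eventually (\<lambda>t. (f ^^ t) x \<notin> nbhd N E0) sequentially" using neg by blast
    qed
    obtain e where "e \<in> E0" using E0(2) by blast
    then have "e \<in> nbhd N E0 \<inter> generic_limit_set f"
      using clopen[OF E0(1)] subset_nbhd[of E0 N] X by auto
    then have "nbhd N E0 \<inter> generic_limit_set f \<noteq> {}" by blast
    from not_comeager_eventually_avoiding[OF open_nbhd this] avoid show False by (rule notE)
  qed
  then obtain W T x where W: "open W" "x \<in> W" "W \<subseteq> L T"
    "\<And>y. y \<in> W \<Longrightarrow> S ((f ^^ T) y) = S ((f ^^ T) x)"
    and freq: "\<exists>\<^sub>F t in sequentially. (f ^^ t) x \<in> nbhd N E0"
    unfolding frequently_def by metis
  \<comment> \<open>\<open>W\<close> is legal from time \<open>T\<close> on, so equality of states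
    at time \<open>T\<close> propagates to all later times.\<close>
  have S_eq: "S ((f ^^ t) y) = S ((f ^^ t) x)" if "y \<in> W" "t \<ge> T" for y t
    using that(2)
  proof (induction t rule: dec_induct)
    case (step t)
    have "(f ^^ t) y \<in> nbhd M X" "(f ^^ t) x \<in> nbhd M X"
      using W(2,3) that(1) step.hyps(1) by (auto simp: L_def)
    from S_step[OF this step.IH] show ?case by simp
  qed (rule W(4)[OF that(1)])
  have "\<exists>\<^sub>F t in sequentially. \<forall>y\<in>W. (f ^^ t) y \<in> nbhd N E0"
    using frequently_eventually_frequently[OF freq eventually_ge_at_top[of T]]
  proof (rule frequently_elim1)
    fix t assume t: "(f ^^ t) x \<in> nbhd N E0 \<and> T \<le> t"
    then have "E0 \<in> S ((f ^^ t) x)" using E0(1) by (simp add: S_def)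
    then have "E0 \<in> S ((f ^^ t) y)" if "y \<in> W" for y using S_eq[OF that] t by simp
    then show "\<forall>y\<in>W. (f ^^ t) y \<in> nbhd N E0" by (simp add: S_def)
  qed
  then show ?thesis using that[of W N] W(1,2) loc[OF E0(1)] by blast
qed

section \<open>Two simultaneous visits and the contradiction\<close>

theorem proposition6:
  fixes X :: "'a::{finite,discrete_topology} config set"
    and Y :: "'b set" and g :: "'b \<Rightarrow> 'b" and \<pi> :: "'a config \<Rightarrow> 'b"
  assumes "subshift X"
    and "finite (pm_chain_components X)"
    and "finite Y"
    and "g \<in> Y \<rightarrow> Y"
    and "\<exists>y\<in>Y. g y \<noteq> y"
    and "continuous_map (top_of_set X) (discrete_topology Y) \<pi>"
    and "\<pi> ` X = Y"
    and "\<forall>x\<in>X. \<pi> (shift x) = g (\<pi> x)"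
  shows "\<not> (\<exists>f::'a config \<Rightarrow> 'a config. cellular_automaton f \<and> generic_limit_set f = X)"
proof
  assume "\<exists>f::'a config \<Rightarrow> 'a config. cellular_automaton f \<and> generic_limit_set f = X"
  then obtain f :: "'a config \<Rightarrow> 'a config" where cont: "continuous_on UNIV f"
    and comm: "f \<circ> shift = shift \<circ> f" and Xf: "X = generic_limit_set f"
    by (auto simp: cellular_automaton_def)
  have clX: "closed X" and tX: "\<And>x k. x \<in> X \<Longrightarrow> translate k x \<in> X"
    using assms(1) by (auto simp: subshift_iff_translate)
  have "g ` Y = Y"
  proof
    show "Y \<subseteq> g ` Y"
    proof
      fix y assume "y \<in> Y"
      then obtain x where x: "x \<in> X" "\<pi> x = y" using assms(7) by blast
      \<comment> \<open>Stepping back along the two-sided orbit makes \<open>g\<close> onto, hence a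
        permutation of the finite set \<open>Y\<close>.\<close>
      have "shift (translate (-1) x) = x" by (simp add: shift_eq_translate)
      then have "y = g (\<pi> (translate (-1) x))" using assms(8) tX x by metis
      then show "y \<in> g ` Y" using tX x(1) assms(7) by blast
    qed
  qed (use assms(4) in auto)
  then obtain p where p: "p > 0" "\<And>y. y \<in> Y \<Longrightarrow> (g ^^ p) y = y"
    using surj_on_finite_funpow_eq_id[OF assms(3)] by metis
  have pi_translate: "\<pi> (translate (int n) x) = (g ^^ n) (\<pi> x)" if "x \<in> X" for n x
  proof (induction n)
    case (Suc n)
    have "translate (int (Suc n)) x = shift (translate (int n) x)" by (simp add: shift_eq_translate)
    then show ?case using Suc assms(8) tX[OF that] by simp
  qed simp
  obtain y0 where y0: "y0 \<in> Y" "g y0 \<noteq> y0" using assms(5) by blast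
  define E0 where "E0 = {x \<in> X. \<pi> x = y0}"
  \<comment> \<open>Every subset of the discrete space \<open>Y\<close> is closed, and relative
    closedness in the closed set \<open>X\<close> is closedness.\<close>
  have fiber: "closed {x \<in> X. \<pi> x \<in> D}" if "D \<subseteq> Y" for D
    using closedin_continuous_map_preimage[OF assms(6), of D] that clX
    by (auto simp: closedin_closed_eq)
  have "E0 = {x \<in> X. \<pi> x \<in> {y0}}" "X - E0 = {x \<in> X. \<pi> x \<in> Y - {y0}}"
    using assms(7) by (auto simp: E0_def)
  then have "closed E0" "closed (X - E0)" using fiber[of "{y0}"] fiber[of "Y - {y0}"] y0(1) by auto
  moreover have "translate (int p) x \<in> E0 \<longleftrightarrow> x \<in> E0" if "x \<in> X" for x
    using pi_translate[OF that, of p] p(2)[of "\<pi> x"] tX[OF that] that assms(7) by (auto simp: E0_def)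
  ultimately have E0: "E0 \<in> invariant_clopens p X"
    by (auto simp: invariant_clopens_def E0_def)
  have "E0 \<noteq> {}" using y0(1) assms(7) by (auto simp: E0_def)
  have fX: "f x \<in> X" if "x \<in> X" for x
    using generic_limit_set_forward_invariant[OF cont] that Xf by simp
  obtain N W where W: "open W" "W \<noteq> {}"
    "\<exists>\<^sub>F t in sequentially. \<forall>x\<in>W. (f ^^ t) x \<in> nbhd N E0"
    and loc: "\<And>z y. y \<in> X \<Longrightarrow> agree N z y \<Longrightarrow> z \<in> nbhd N E0 \<longleftrightarrow> y \<in> E0"
    by (rule uniformly_recurrent_clopen[OF cont Xf finite_invariant_clopens[OF assms(1,2) p(1)] _
          preimage_invariant_clopens[OF cont comm assms(1) fX] E0 \<open>E0 \<noteq> {}\<close>])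
      (auto simp: invariant_clopens_def)
  obtain M where M: "\<And>d. d > 2 * M \<Longrightarrow> W \<inter> translate (int d) -` W \<noteq> {}"
    using open_translate_meets[OF W(1)] W(2) by blast
  \<comment> \<open>Congruent to 1 modulo \<open>p\<close>, and larger than \<open>2 * M\<close>
    because \<open>p > 0\<close>.\<close>
  define d where "d = Suc (p * (2 * M))"
  have "d > 2 * M" using p(1) by (simp add: d_def less_Suc_eq_le)
  moreover have "open (W \<inter> translate (int d) -` W)"
    by (intro open_Int W(1) open_vimage continuous_translate)
  \<comment> \<open>Radius \<open>N + d\<close> covers the windows of radius \<open>N\<close> about
    both 0 and \<open>d\<close>, so a single point of \<open>X\<close> will carry both
    patterns.\<close>
  ultimately obtain x where x: "x \<in> W" "translate (int d) x \<in> W"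
    and ev: "eventually (\<lambda>t. (f ^^ t) x \<in> nbhd (N + d) X) sequentially"
    using comeager_meets_open[OF comeager_eventually_nbhd[of f "N + d"]] M Xf by blast
  \<comment> \<open>The common visits of \<open>W\<close> recur infinitely often, and
    \<open>x\<close> stays legal from some time on. As \<open>x\<close> and its translate lie in
    \<open>W\<close>, both make the visit at this \<open>t\<close>.\<close>
  obtain t where t: "\<forall>x\<in>W. (f ^^ t) x \<in> nbhd N E0" "(f ^^ t) x \<in> nbhd (N + d) X"
    using frequently_ex[OF frequently_eventually_frequently[OF W(3) ev]] by blast
  obtain y where y: "y \<in> X" "agree (N + d) ((f ^^ t) x) y" using t(2) by (auto simp: nbhd_def)
  have "y \<in> E0" using loc[OF y(1)] agree_mono[OF y(2)] t(1) x(1) by auto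
  moreover have "translate (int d) y \<in> E0"
    using loc[OF tX[OF y(1)] agree_translate[OF y(2)]] t(1) x(2)
    by (simp add: funpow_translate_commute[OF comm, symmetric])
  \<comment> \<open>Hence the d-th power of \<open>g\<close> sends \<open>y0\<close> to
    \<open>g y0\<close>, whereas \<open>y\<close> and its translate by \<open>d\<close> both lie
    over \<open>y0\<close>.\<close>
  moreover have "(g ^^ (p * n)) y0 = y0" for n
    by (induction n) (simp_all add: funpow_add p(2)[OF y0(1)])
  ultimately show False
    using pi_translate[OF y(1), of d] y0(2) by (simp add: d_def E0_def)
qed

end
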